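(* Let $(X,\|\cdot\|)$ be a real normed space, $X\neq\{0\}$, and $b:X\to(-\infty,\infty]$. Let $K:=\mathrm{dom}(b)=\{x\in X: b(x)<\infty\}$ and suppose that $b$ is convex on a nonempty convex subset $S$ of $K$. Let $\psi_{b,S}$ be the modulus of uniform convexity of $b$ on $S$. Then $\phi(t):=\psi_{b,S}(t)/t^2$ is increasing on $(0,\infty)$ and $\psi_{b,S}$ is increasing on $[0,\infty)$ (and both of them are strictly increasing on $[0,\mathrm{diam}(K))$ if $b$ is uniformly convex). In addition, $$\psi_{b,S}(ct)\ge c^2\psi_{b,S}(t)\quad\forall c\ge1,\ \forall t\ge0,$$ and $$\psi_{b,S}(ct)\le c^2\psi_{b,S}(t)\quad\forall c\in(0,1),\ \forall t\ge0.$$ Hence, if $S$ is not a singleton, then $\psi_{b,S}(c)$ decays to zero at least as fast as a quadratic function in $c$ when $c\to0$. If $S$ is unbounded and if $\psi_{b,S}(t_0)>0$ for some $t_0>0$ (as happens, in particular, if $b$ is uniformly convex on $S$), then $\psi_{b,S}(c)$ grows to infinity at least as fast as a quadratic function in $c$ when $c$ grows to infinity.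
   Context: The modulus of uniform convexity of $b$ on $S$ is the function $\psi_{b,S}:[0,\infty)\to[0,\infty]$, $$\psi_{b,S}(t):=\inf\Big\{\tfrac{\lambda b(x)+(1-\lambda)b(y)-b(\lambda x+(1-\lambda)y)}{\lambda(1-\lambda)}:x,y\in S,\ \|x-y\|=t,\ \lambda\in(0,1)\Big\},\quad\inf\emptyset:=\infty.$$ It is defined even if $b$ is not uniformly convex. $b$ is uniformly convex on $S$ if and only if $\psi_{b,S}(t)>0$ for every $t\in(0,\infty)$. "Increasing" means nondecreasing, as opposed to "strictly increasing". $\mathrm{diam}(K):=\sup\{\|x-y\|:x,y\in K\}\in[0,\infty]$. Arithmetic in $[0,\infty]$ uses $c\cdot\infty=\infty$ for $c>0$. The decay claim means that there are $t_0>0$ and $M\in[0,\infty)$ with $\psi_{b,S}(c)\le Mc^2$ for all $c\in(0,t_0)$; the growth claim means that there are $m>0$ and $c_0>0$ with $\psi_{b,S}(c)\ge mc^2$ for all $c>c_0$.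
   Formalization: Strictness of φ is omitted (false: for b(x)=x² on ℝ, φ is constant 1); if b is uniformly convex on S, ψ is claimed strictly increasing on [0,diam(S)) instead of [0,diam(K)), as ψ=∞ beyond diam(S). *)

theory Defs
  imports "HOL-Analysis.Analysis"
begin

definition dom_ereal :: "('a \<Rightarrow> ereal) \<Rightarrow> 'a set" where
  "dom_ereal b = {x. b x < \<infinity>}"

(* The quotient is meant for S inside the domain of b, with b > -\<infinity> and S convex: then all
   values of b that occur are finite. The infimum of the empty set is \<infinity> in ereal. *)
definition uc_modulus :: "('a::real_normed_vector \<Rightarrow> ereal) \<Rightarrow> 'a set \<Rightarrow> real \<Rightarrow> ereal" where
  "uc_modulus b S t =
     Inf {(ereal l * b x + ereal (1 - l) * b y - b (l *\<^sub>R x + (1 - l) *\<^sub>R y)) / ereal (l * (1 - l)) | x y l.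
            x \<in> S \<and> y \<in> S \<and> norm (x - y) = t \<and> 0 < l \<and> l < 1}"

definition uniformly_convex_on :: "'a::real_normed_vector set \<Rightarrow> ('a \<Rightarrow> ereal) \<Rightarrow> bool" where
  "uniformly_convex_on S b \<longleftrightarrow> (\<forall>t>0. uc_modulus b S t > 0)"

(* The diameter with values in [0,\<infinity>]; the library constant diameter is real-valued and
   not informative on unbounded sets.

   On strict monotonicity under uniform convexity: for the square function on the real line the
   modulus is t^2, so the quotient modulus(t)/t^2 is constant and only the modulus itself can be
   strictly increasing. Beyond the diameter of S the modulus is constantly \<infinity>, so the range of
   strictness is [0, ext_diam S), which is [0, ext_diam (dom_ereal b)) when S is the domain. *)
definition ext_diam :: "'a::real_normed_vector set \<Rightarrow> ereal" where
  "ext_diam A = Sup {ereal (norm (x - y)) | x y. x \<in> A \<and> y \<in> A}"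

end

theory Submission
  imports Defs
begin

text \<open>
  Up to the factor \<open>\<parallel>x - y\<parallel>\<^sup>2\<close>, the quotient whose infimum is the modulus \<open>\<psi>\<close> is the second divided
  difference of \<open>b\<close> on the segment from \<open>x\<close> to \<open>y\<close>. So \<open>\<psi>(t) / t\<^sup>2\<close> is the infimum of the second divided
  differences over segments of length \<open>t\<close>, and a divided difference over a long segment is an average
  of divided differences over shorter ones. This is why \<open>\<psi>(t) / t\<^sup>2\<close> increases, that is, why
  \<open>\<psi>(c t) \<ge> c\<^sup>2 \<psi>(t)\<close> for \<open>c \<ge> 1\<close>.

  To prove the inequality for \<open>1 < c < 2\<close>, cut a segment from \<open>x\<close> to \<open>y\<close> of length \<open>c t\<close> at the point
  \<open>u\<close> at distance \<open>t\<close> from \<open>y\<close>. If the point \<open>z\<close> with weight \<open>\<lambda>\<close> on \<open>x\<close> lies between \<open>u\<close> and \<open>y\<close>,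
  the convexity gap at \<open>z\<close> is the gap at \<open>z\<close> on the short segment from \<open>u\<close> to \<open>y\<close> plus a multiple of
  the gap at \<open>u\<close> on the long segment (\<open>gap_split\<close>). The first is bounded below by
  \<open>\<psi>(t)\<close> and the second by \<open>\<psi>(c t)\<close>; choosing \<open>x\<close>, \<open>y\<close>, \<open>\<lambda>\<close> nearly optimal for \<open>\<psi>(c t)\<close> makes
  \<open>\<psi>(c t)\<close> appear on both sides, and solving for it gives the claim (\<open>modulus_scale_below_2\<close>).
  By symmetry \<open>\<lambda> \<le> 1/2\<close> may be assumed, so \<open>c < 2\<close> puts \<open>z\<close> strictly between \<open>u\<close> and \<open>y\<close>. Larger factors
  \<open>c\<close> are products of factors at most \<open>3/2\<close>.

  Everything else follows from this inequality, from \<open>\<psi>(0) = 0\<close>, from \<open>\<psi> \<ge> 0\<close> (which is convexity),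
  and from the finiteness of \<open>\<psi>(t)\<close> whenever \<open>S\<close> contains two points at distance \<open>t\<close> or more.
\<close>

section \<open>The convexity gap\<close>

definition convexity_gap :: "('a::real_vector \<Rightarrow> real) \<Rightarrow> 'a \<Rightarrow> 'a \<Rightarrow> real \<Rightarrow> real" where
  "convexity_gap f x y l = l * f x + (1 - l) * f y - f (l *\<^sub>R x + (1 - l) *\<^sub>R y)"

lemma convexity_gap_swap: "convexity_gap f x y l = convexity_gap f y x (1 - l)"
  by (simp add: convexity_gap_def algebra_simps)

lemma convexity_gap_nonneg:
  assumes "convex_on S f" "x \<in> S" "y \<in> S" "0 < l" "l < 1"
  shows "0 \<le> convexity_gap f x y l"
  using convex_onD[OF assms(1), of "1 - l" x y] assms by (simp add: convexity_gap_def)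

text \<open>
  With \<open>u = y + (x - y) / c\<close>, the point with weight \<open>l\<close> on \<open>x\<close> is also the point with weight
  \<open>l * c\<close> on \<open>u\<close>; the values of \<open>f\<close> at \<open>u\<close> cancel.
\<close>

lemma gap_split:
  assumes "c \<noteq> 0"
  shows "convexity_gap f x y l =
    convexity_gap f ((1/c) *\<^sub>R x + (1 - 1/c) *\<^sub>R y) y (l * c) + l * c * convexity_gap f x y (1/c)"
proof -
  have "(l * c) *\<^sub>R ((1/c) *\<^sub>R x + (1 - 1/c) *\<^sub>R y) + (1 - l * c) *\<^sub>R y
      = (l * c * (1/c)) *\<^sub>R x + (l * c * (1 - 1/c) + (1 - l * c)) *\<^sub>R y"
    by (simp only: scaleR_add_right scaleR_add_left scaleR_scaleR add.assoc)
  also have "\<dots> = l *\<^sub>R x + (1 - l) *\<^sub>R y"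
    using assms by (simp add: right_diff_distrib)
  finally have point: "(l * c) *\<^sub>R ((1/c) *\<^sub>R x + (1 - 1/c) *\<^sub>R y) + (1 - l * c) *\<^sub>R y
      = l *\<^sub>R x + (1 - l) *\<^sub>R y" .
  show ?thesis
    unfolding convexity_gap_def point using assms
    by (simp add: right_diff_distrib distrib_left left_diff_distrib)
qed

lemma convex_ex_dist_eq:
  fixes S :: "'a::real_normed_vector set"
  assumes "convex S" "x \<in> S" "y \<in> S" "0 \<le> t" "t \<le> norm (x - y)"
  obtains u where "u \<in> S" "norm (u - y) = t"
proof (cases "x = y")
  case True
  then show ?thesis using assms that[of y] by simp
next
  case False
  define a where "a = t / norm (x - y)"
  have a: "0 \<le> a" "a \<le> 1" using assms False by (auto simp: a_def divide_simps)
  have "a *\<^sub>R x + (1 - a) *\<^sub>R y \<in> S" using assms a by (intro convexD) auto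
  moreover have "a *\<^sub>R x + (1 - a) *\<^sub>R y - y = a *\<^sub>R (x - y)" by (simp add: algebra_simps)
  then have "norm (a *\<^sub>R x + (1 - a) *\<^sub>R y - y) = t" using False assms(4) by (simp add: a_def)
  ultimately show ?thesis using that by blast
qed

section \<open>The modulus of a convex function\<close>

locale real_valued_convex_on =
  fixes b :: "'a::real_normed_vector \<Rightarrow> ereal" and S :: "'a set"
  assumes b_proper: "\<And>x. b x \<noteq> -\<infinity>"
    and S_dom: "S \<subseteq> dom_ereal b"
    and S_nonempty: "S \<noteq> {}"
    and S_convex: "convex S"
    and b_convex: "convex_on S (\<lambda>x. real_of_ereal (b x))"
begin

abbreviation gap :: "'a \<Rightarrow> 'a \<Rightarrow> real \<Rightarrow> real" where
  "gap \<equiv> convexity_gap (\<lambda>x. real_of_ereal (b x))"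

lemma b_eq_ereal: "x \<in> S \<Longrightarrow> b x = ereal (real_of_ereal (b x))"
  using b_proper[of x] S_dom by (cases "b x") (auto simp: dom_ereal_def)

lemma quotient_eq_gap:
  assumes "x \<in> S" "y \<in> S" "0 < l" "l < 1"
  shows "(ereal l * b x + ereal (1 - l) * b y - b (l *\<^sub>R x + (1 - l) *\<^sub>R y)) / ereal (l * (1 - l))
    = ereal (gap x y l / (l * (1 - l)))"
proof -
  have "l *\<^sub>R x + (1 - l) *\<^sub>R y \<in> S" using assms by (intro convexD[OF S_convex]) auto
  then obtain p q r where "b x = ereal p" "b y = ereal q" "b (l *\<^sub>R x + (1 - l) *\<^sub>R y) = ereal r"
    using assms b_eq_ereal by blast
  then show ?thesis using assms by (simp add: convexity_gap_def)
qed

text \<open>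
  All reasoning about the infimum passes through real lower bounds \<open>r\<close>, which brings it down to
  inequalities between real numbers, even where the modulus is infinite.
\<close>

lemma le_modulus_iff:
  "ereal r \<le> uc_modulus b S t \<longleftrightarrow>
    (\<forall>x\<in>S. \<forall>y\<in>S. \<forall>l. norm (x - y) = t \<longrightarrow> 0 < l \<longrightarrow> l < 1 \<longrightarrow> r * (l * (1 - l)) \<le> gap x y l)"
proof -
  have "ereal r \<le> uc_modulus b S t \<longleftrightarrow>
    (\<forall>x\<in>S. \<forall>y\<in>S. \<forall>l. norm (x - y) = t \<longrightarrow> 0 < l \<longrightarrow> l < 1 \<longrightarrow>
       ereal r \<le> (ereal l * b x + ereal (1 - l) * b y - b (l *\<^sub>R x + (1 - l) *\<^sub>R y)) / ereal (l * (1 - l)))"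
    unfolding uc_modulus_def le_Inf_iff by blast
  also have "\<dots> \<longleftrightarrow> (\<forall>x\<in>S. \<forall>y\<in>S. \<forall>l. norm (x - y) = t \<longrightarrow> 0 < l \<longrightarrow> l < 1 \<longrightarrow>
       ereal r \<le> ereal (gap x y l / (l * (1 - l))))"
    by (simp only: quotient_eq_gap cong: ball_cong imp_cong)
  also have "\<dots> \<longleftrightarrow> (\<forall>x\<in>S. \<forall>y\<in>S. \<forall>l. norm (x - y) = t \<longrightarrow> 0 < l \<longrightarrow> l < 1 \<longrightarrow> r * (l * (1 - l)) \<le> gap x y l)"
    by (simp add: pos_le_divide_eq)
  finally show ?thesis .
qed

lemma modulus_le_gap:
  assumes "x \<in> S" "y \<in> S" "0 < l" "l < 1"
  shows "uc_modulus b S (norm (x - y)) \<le> ereal (gap x y l / (l * (1 - l)))"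
  unfolding quotient_eq_gap[OF assms, symmetric] uc_modulus_def
  by (rule Inf_lower) (use assms in blast)

lemma modulus_nonneg: "0 \<le> uc_modulus b S t"
  using le_modulus_iff[of 0 t] convexity_gap_nonneg[OF b_convex] by (simp add: zero_ereal_def)

lemma modulus_zero: "uc_modulus b S 0 = 0"
proof -
  obtain x where "x \<in> S" using S_nonempty by blast
  from modulus_le_gap[OF this this, of "1/2"] have "uc_modulus b S 0 \<le> 0"
    by (simp add: convexity_gap_def zero_ereal_def flip: scaleR_add_left)
  then show ?thesis using modulus_nonneg by (simp add: order_antisym)
qed

lemma modulus_finite:
  assumes "x \<in> S" "y \<in> S" "0 \<le> t" "t \<le> norm (x - y)"
  shows "uc_modulus b S t < \<infinity>"
proof -
  obtain u where "u \<in> S" "norm (u - y) = t"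
    using convex_ex_dist_eq[OF S_convex assms] .
  then show ?thesis
    using modulus_le_gap[of u y "1/2"] assms(2) by (auto simp: less_top[symmetric] top_ereal_def)
qed

lemma modulus_finite_below_diam:
  assumes "0 \<le> t" "ereal t < ext_diam S"
  shows "uc_modulus b S t < \<infinity>"
proof -
  from assms(2) obtain x y where "x \<in> S" "y \<in> S" "t < norm (x - y)"
    unfolding ext_diam_def less_Sup_iff by auto
  then show ?thesis using modulus_finite[of x y t] assms(1) by simp
qed

section \<open>Quadratic scaling\<close>

text \<open>
  The bounds from \<open>gap_split\<close> for a nearly optimal \<open>x\<close>, \<open>y\<close>, \<open>l\<close> say, after division by \<open>l\<close>, that
  \<open>c (1 - l c) \<psi>(t) + (1 - 1/c) \<psi>(c t)\<close> is at most about \<open>(1 - l) \<psi>(c t)\<close>. The terms in \<open>\<psi>(c t)\<close> combine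
  to \<open>(1 - l c) \<psi>(c t) / c\<close>, so the positive factor \<open>1 - l c\<close> cancels and leaves \<open>c\<^sup>2 \<psi>(t) \<le> \<psi>(c t)\<close>.
  As \<open>l\<close> depends on the error, \<open>1 - l c\<close> must stay away from \<open>0\<close>; it is at least \<open>1 - c/2\<close>.
\<close>

lemma modulus_scale_below_2:
  assumes c: "1 < c" "c < 2" and t: "0 \<le> t" and m: "ereal m \<le> uc_modulus b S t"
  shows "ereal (c\<^sup>2 * m) \<le> uc_modulus b S (c * t)"
proof (rule ccontr)
  assume neg: "\<not> ?thesis"
  then obtain M where M: "uc_modulus b S (c * t) = ereal M" "M < c\<^sup>2 * m"
    using modulus_nonneg[of "c * t"] by (cases "uc_modulus b S (c * t)") auto
  define d where "d = c * m - M / c"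
  have d: "0 < d" using M(2) c by (simp add: d_def field_simps power2_eq_square)
  \<comment> \<open>The error must not exceed \<open>(1 - l * c) * d\<close> for the near-optimal \<open>l \<le> 1/2\<close>.\<close>
  define e where "e = (1 - c/2) * d"
  have e: "0 < e" using d c by (simp add: e_def)
  have "\<not> ereal (M + e) \<le> uc_modulus b S (c * t)" using M e by simp
  then obtain x0 y0 l0 where xy0: "x0 \<in> S" "y0 \<in> S" "norm (x0 - y0) = c * t" "0 < l0" "l0 < 1"
      "gap x0 y0 l0 < (M + e) * (l0 * (1 - l0))"
    unfolding le_modulus_iff by (meson not_le)
  obtain x y l where xy: "x \<in> S" "y \<in> S" "norm (x - y) = c * t" "0 < l" "l \<le> 1/2"
      and lt: "gap x y l < (M + e) * (l * (1 - l))"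
  proof (cases "l0 \<le> 1/2")
    case True
    then show ?thesis using that xy0 by blast
  next
    case False
    then show ?thesis
      using that[of y0 x0 "1 - l0"] xy0 convexity_gap_swap[of _ x0 y0 l0]
      by (simp add: norm_minus_commute mult.commute)
  qed
  define u where "u = (1/c) *\<^sub>R x + (1 - 1/c) *\<^sub>R y"
  have u: "u \<in> S" unfolding u_def using xy c by (intro convexD[OF S_convex]) auto
  have "u - y = (1/c) *\<^sub>R (x - y)" by (simp add: u_def algebra_simps)
  then have nu: "norm (u - y) = t" using xy c by simp
  have "l * c \<le> 1/2 * c" using xy c by (intro mult_right_mono) auto
  then have lc: "l * c \<le> c/2" by simp
  have short: "m * (l * c * (1 - l * c)) \<le> gap u y (l * c)"
  proof -
    have "0 < l * c" using c xy by simp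
    moreover have "l * c < 1" using lc c by linarith
    ultimately show ?thesis using m[unfolded le_modulus_iff] u xy(2) nu by blast
  qed
  have "M * (1/c * (1 - 1/c)) \<le> gap x y (1/c)"
  proof -
    have "0 < 1/c" "1/c < 1" using c by auto
    then show ?thesis using M(1)[THEN eq_refl[OF sym], unfolded le_modulus_iff] xy(1-3) by blast
  qed
  then have "l * c * (M * (1/c * (1 - 1/c))) \<le> l * c * gap x y (1/c)"
    using xy c by (intro mult_left_mono) auto
  then have "m * (l * c * (1 - l * c)) + l * c * (M * (1/c * (1 - 1/c))) \<le> gap x y l"
    using short gap_split[of c "\<lambda>x. real_of_ereal (b x)" x y l] c by (simp add: u_def)
  with lt have "l * (m * c * (1 - l * c) + M * (1 - 1/c)) < l * ((M + e) * (1 - l))"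
    using c by (simp add: algebra_simps)
  then have "m * c * (1 - l * c) + M * (1 - 1/c) < (M + e) * (1 - l)"
    using xy by simp
  moreover have "m * c * (1 - l * c) + M * (1 - 1/c) - M * (1 - l) = (1 - l * c) * d"
    using c by (simp add: d_def field_simps)
  ultimately have "(1 - l * c) * d < e * (1 - l)" by (simp add: algebra_simps)
  also have "\<dots> \<le> e * 1" using e xy by (intro mult_left_mono) auto
  also have "\<dots> \<le> (1 - l * c) * d"
    unfolding e_def using d lc by simp
  finally show False by simp
qed

lemma modulus_scale_real:
  assumes "1 \<le> c" "0 \<le> t" "ereal m \<le> uc_modulus b S t"
  shows "ereal (c\<^sup>2 * m) \<le> uc_modulus b S (c * t)"
proof -
  obtain n where "c < (3/2) ^ n" using real_arch_pow[of "3/2" c] by auto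
  with assms(1) show ?thesis
  proof (induction n arbitrary: c)
    case (Suc n)
    consider "c = 1" | "1 < c" "c < 2" | "2 \<le> c" using Suc.prems by linarith
    then show ?case
    proof cases
      case 3
      have "ereal ((c / (3/2))\<^sup>2 * m) \<le> uc_modulus b S (c / (3/2) * t)"
        using Suc 3 by (intro Suc.IH) auto
      from modulus_scale_below_2[OF _ _ _ this, of "3/2"] assms(2) 3
      show ?thesis by (simp add: power2_eq_square mult.assoc)
    qed (use assms modulus_scale_below_2 in auto)
  qed simp
qed

lemma modulus_scale_ge:
  assumes "1 \<le> c" "0 \<le> t"
  shows "ereal (c\<^sup>2) * uc_modulus b S t \<le> uc_modulus b S (c * t)"
proof (cases "uc_modulus b S t")
  case (real m)
  then show ?thesis using modulus_scale_real[OF assms, of m] by simp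
next
  case PInf
  have "ereal r \<le> uc_modulus b S (c * t)" for r
    using modulus_scale_real[OF assms, of "r / c\<^sup>2"] PInf assms(1) by simp
  then have "uc_modulus b S (c * t) = \<infinity>" by (metis ereal_top)
  then show ?thesis by simp
next
  case MInf
  then show ?thesis using modulus_nonneg[of t] by simp
qed

lemma modulus_scale_le:
  assumes "0 < c" "c < 1" "0 \<le> t"
  shows "uc_modulus b S (c * t) \<le> ereal (c\<^sup>2) * uc_modulus b S t"
proof -
  have "ereal ((1/c)\<^sup>2) * uc_modulus b S (c * t) \<le> uc_modulus b S t"
    using modulus_scale_ge[of "1/c" "c * t"] assms by simp
  then have "ereal (c\<^sup>2) * (ereal ((1/c)\<^sup>2) * uc_modulus b S (c * t)) \<le> ereal (c\<^sup>2) * uc_modulus b S t"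
    by (rule ereal_mult_left_mono) simp
  moreover have "ereal (c\<^sup>2) * (ereal ((1/c)\<^sup>2) * uc_modulus b S (c * t)) = uc_modulus b S (c * t)"
    using assms by (simp add: mult.assoc[symmetric] power_divide one_ereal_def[symmetric])
  ultimately show ?thesis by simp
qed

section \<open>Monotonicity, decay and growth\<close>

lemma mono_on_modulus_quotient: "mono_on {0<..} (\<lambda>t. uc_modulus b S t / ereal (t\<^sup>2))"
proof (rule mono_onI)
  fix s t :: real
  assume "s \<in> {0<..}" "t \<in> {0<..}" "s \<le> t"
  then have st: "0 < s" "0 < t" "s \<le> t" by auto
  have "ereal ((t/s)\<^sup>2) * uc_modulus b S s \<le> uc_modulus b S t"
    using modulus_scale_ge[of "t/s" s] st by simp
  then have "ereal ((t/s)\<^sup>2) * uc_modulus b S s / ereal (t\<^sup>2) \<le> uc_modulus b S t / ereal (t\<^sup>2)"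
    using st by (intro ereal_divide_right_mono) auto
  moreover have "ereal ((t/s)\<^sup>2) * uc_modulus b S s / ereal (t\<^sup>2) = uc_modulus b S s / ereal (s\<^sup>2)"
    using st modulus_nonneg[of s] by (cases "uc_modulus b S s") (auto simp: field_simps)
  ultimately show "uc_modulus b S s / ereal (s\<^sup>2) \<le> uc_modulus b S t / ereal (t\<^sup>2)" by simp
qed

lemma mono_on_modulus: "mono_on {0..} (uc_modulus b S)"
proof (rule mono_onI)
  fix s t :: real
  assume st: "s \<in> {0..}" "t \<in> {0..}" "s \<le> t"
  show "uc_modulus b S s \<le> uc_modulus b S t"
  proof (cases "s = 0")
    case True
    then show ?thesis by (simp add: modulus_zero modulus_nonneg)
  next
    case False
    have "1 * uc_modulus b S s \<le> ereal ((t/s)\<^sup>2) * uc_modulus b S s"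
      using st False by (intro ereal_mult_right_mono modulus_nonneg) (auto simp: one_ereal_def)
    also have "\<dots> \<le> uc_modulus b S t"
      using modulus_scale_ge[of "t/s" s] st False by simp
    finally show ?thesis by simp
  qed
qed

text \<open>
  Strictness needs \<open>\<psi>(s)\<close> to be positive and finite, so that multiplying it by \<open>(t/s)\<^sup>2 > 1\<close> increases it;
  finiteness is what restricts the claim to arguments below the diameter of \<open>S\<close>.
\<close>

lemma strict_mono_on_modulus:
  assumes "uniformly_convex_on S b"
  shows "strict_mono_on {t. 0 \<le> t \<and> ereal t < ext_diam S} (uc_modulus b S)"
proof (rule strict_mono_onI)
  fix s t :: real
  assume "s \<in> {t. 0 \<le> t \<and> ereal t < ext_diam S}" "s < t"
  then have st: "0 \<le> s" "s < t" "ereal s < ext_diam S" by auto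
  show "uc_modulus b S s < uc_modulus b S t"
  proof (cases "s = 0")
    case True
    then show ?thesis using assms st by (simp add: modulus_zero uniformly_convex_on_def)
  next
    case False
    then have s: "0 < s" using st by simp
    then have "0 < uc_modulus b S s" using assms by (simp add: uniformly_convex_on_def)
    then obtain m where m: "uc_modulus b S s = ereal m" "0 < m"
      using modulus_finite_below_diam[of s] st by (cases "uc_modulus b S s") auto
    have "1 < (t/s)\<^sup>2" using st s by (intro one_less_power) auto
    then have "ereal m < ereal ((t/s)\<^sup>2 * m)" using m by simp
    also have "\<dots> \<le> uc_modulus b S t"
      using modulus_scale_ge[of "t/s" s] st s m by simp
    finally show ?thesis by (simp add: m)
  qed
qed

lemma modulus_quadratic_decay:
  assumes "\<not> is_singleton S"
  shows "\<exists>t0>0. \<exists>M\<ge>0. \<forall>c. 0 < c \<and> c < t0 \<longrightarrow> uc_modulus b S c \<le> ereal (M * c\<^sup>2)"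
proof -
  obtain x y where xy: "x \<in> S" "y \<in> S" "x \<noteq> y"
    using assms S_nonempty by (metis is_singletonI')
  define t0 where "t0 = norm (x - y)"
  have t0: "0 < t0" using xy by (simp add: t0_def)
  obtain M where M: "uc_modulus b S t0 = ereal M" "0 \<le> M"
    using modulus_finite[of x y t0] modulus_nonneg[of t0] xy t0
    by (cases "uc_modulus b S t0") (auto simp: t0_def)
  have "uc_modulus b S c \<le> ereal (M / t0\<^sup>2 * c\<^sup>2)" if "0 < c" "c < t0" for c
    using modulus_scale_le[of "c / t0" t0] that t0 M by (simp add: power_divide mult.commute)
  moreover have "0 \<le> M / t0\<^sup>2" using M by simp
  ultimately show ?thesis using t0 by blast
qed

lemma modulus_quadratic_growth:
  assumes "0 < t0" "0 < uc_modulus b S t0"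
  shows "\<exists>m>0. \<exists>c0>0. \<forall>c>c0. ereal (m * c\<^sup>2) \<le> uc_modulus b S c"
proof -
  \<comment> \<open>The modulus at \<open>t0\<close> may be infinite.\<close>
  obtain m where m: "0 < m" "ereal m \<le> uc_modulus b S t0"
    using ereal_dense2[OF assms(2)] by (auto simp: zero_ereal_def intro: less_imp_le)
  have "ereal (m / t0\<^sup>2 * c\<^sup>2) \<le> uc_modulus b S c" if "t0 < c" for c
    using modulus_scale_real[of "c / t0" t0 m] that assms(1) m by (simp add: power_divide mult.commute)
  moreover have "0 < m / t0\<^sup>2" using m assms(1) by simp
  ultimately show ?thesis using assms(1) by blast
qed

end

theorem lemma3p3:
  fixes b :: "'a::real_normed_vector \<Rightarrow> ereal" and S :: "'a set"
  assumes X_nontrivial: "\<exists>x::'a. x \<noteq> 0"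
    and b_proper: "\<And>x. b x \<noteq> -\<infinity>"
    and S_dom: "S \<subseteq> dom_ereal b"
    and S_nonempty: "S \<noteq> {}"
    and S_convex: "convex S"
    and b_convex: "convex_on S (\<lambda>x. real_of_ereal (b x))"
  shows "mono_on {0<..} (\<lambda>t. uc_modulus b S t / ereal (t\<^sup>2))
    \<and> mono_on {0..} (uc_modulus b S)
    \<and> (uniformly_convex_on S b \<longrightarrow>
         strict_mono_on {t. 0 \<le> t \<and> ereal t < ext_diam S} (uc_modulus b S))
    \<and> (\<forall>c\<ge>1. \<forall>t\<ge>0. uc_modulus b S (c * t) \<ge> ereal (c\<^sup>2) * uc_modulus b S t)
    \<and> (\<forall>c. 0 < c \<and> c < 1 \<longrightarrow>
         (\<forall>t\<ge>0. uc_modulus b S (c * t) \<le> ereal (c\<^sup>2) * uc_modulus b S t))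
    \<and> (\<not> is_singleton S \<longrightarrow>
         (\<exists>t0>0. \<exists>M\<ge>0. \<forall>c. 0 < c \<and> c < t0 \<longrightarrow> uc_modulus b S c \<le> ereal (M * c\<^sup>2)))
    \<and> (uniformly_convex_on S b \<longrightarrow> (\<exists>t0>0. uc_modulus b S t0 > 0))
    \<and> (\<not> bounded S \<and> (\<exists>t0>0. uc_modulus b S t0 > 0) \<longrightarrow>
         (\<exists>m>0. \<exists>c0>0. \<forall>c>c0. uc_modulus b S c \<ge> ereal (m * c\<^sup>2)))"
proof -
  interpret real_valued_convex_on b S
    using b_proper S_dom S_nonempty S_convex b_convex by unfold_locales
  have "uniformly_convex_on S b \<longrightarrow> (\<exists>t0>0. uc_modulus b S t0 > 0)"
    unfolding uniformly_convex_on_def using zero_less_one by blast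
  then show ?thesis
    using mono_on_modulus_quotient mono_on_modulus strict_mono_on_modulus modulus_scale_ge
      modulus_scale_le modulus_quadratic_decay modulus_quadratic_growth
    by blast
qed

end
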